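(* For all $n\ge 0$, $\left|\mathcal{S}^2_n(213)\right|=\left|\mathcal{S}^2_n(312)\right|$.
   Context: $\mathcal{S}^2_n(P)$ denotes the set of permutations $\pi\in\mathcal{S}_{3n}$ that avoid every pattern in $P$ (classical pattern avoidance) and satisfy $\pi_{3i+1}<\pi_{3i+2}$ and $\pi_{3i+1}<\pi_{3i+3}$ for all $0\le i<n$. *)

theory Defs
  imports "HOL-Library.Sublist" "HOL-Combinatorics.Multiset_Permutations"
begin

(* Permutations of [m] are lists in one-line notation, i.e. elements of
   permutations_of_set {1..m}; list positions count from 0, so \<pi> ! i is the
   (i+1)-st entry of the permutation. Patterns are lists in one-line notation too: 213 is [2, 1, 3]. *)

definition order_isomorphic :: "nat list \<Rightarrow> nat list \<Rightarrow> bool" where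
  "order_isomorphic xs ys \<longleftrightarrow> length xs = length ys \<and>
     (\<forall>i < length xs. \<forall>j < length xs. xs ! i < xs ! j \<longleftrightarrow> ys ! i < ys ! j)"

(* subseq: not necessarily contiguous, as in classical pattern containment *)
definition contains_pattern :: "nat list \<Rightarrow> nat list \<Rightarrow> bool" where
  "contains_pattern \<pi> \<sigma> \<longleftrightarrow> (\<exists>xs. subseq xs \<pi> \<and> order_isomorphic xs \<sigma>)"

definition avoids :: "nat list \<Rightarrow> nat list \<Rightarrow> bool" where
  "avoids \<pi> \<sigma> \<longleftrightarrow> \<not> contains_pattern \<pi> \<sigma>"

definition S2 :: "nat \<Rightarrow> nat list set \<Rightarrow> nat list set" where
  "S2 n P = {\<pi> \<in> permutations_of_set {1..3 * n}.
     (\<forall>\<sigma> \<in> P. avoids \<pi> \<sigma>) \<and>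
     (\<forall>i < n. \<pi> ! (3 * i) < \<pi> ! (3 * i + 1) \<and> \<pi> ! (3 * i) < \<pi> ! (3 * i + 2))}"

lemma finite_S2: "finite (S2 n P)"
  unfolding S2_def by simp

end

theory Submission
  imports Defs
begin

text \<open>
  Writing a permutation as \<open>A 1 B\<close> around its minimum, it avoids 312 iff \<open>A\<close> and \<open>B\<close> do and all of
  \<open>A\<close> lies below all of \<open>B\<close>; for 213, all of \<open>A\<close> lies above all of \<open>B\<close>. Iterating, the avoiders
  of either pattern correspond bijectively to binary trees, namely their Cartesian trees. The
  condition on the blocks says that each block has its minimum in first place, and the position of
  the minimum of an interval of positions depends only on the Cartesian tree.
\<close>

datatype bin_tree = Leaf | Node bin_tree bin_tree

text \<open>The flag selects the pattern: 312 if true and 213 if false. The labels start at \<open>k\<close>.\<close>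

fun tree_word :: "bool \<Rightarrow> nat \<Rightarrow> bin_tree \<Rightarrow> nat list" where
  "tree_word s k Leaf = []"
| "tree_word s k (Node l r) =
     tree_word s (if s then k + 1 else k + 1 + size r) l @
     k # tree_word s (if s then k + 1 + size l else k + 1) r"

section \<open>Pattern occurrences, and splitting a word at its minimum\<close>

definition occurs3 :: "bool \<Rightarrow> nat list \<Rightarrow> bool" where
  "occurs3 s p \<longleftrightarrow> (\<exists>x y z. subseq [x, y, z] p \<and> (if s then y < z \<and> z < x else y < x \<and> x < z))"

lemma order_isomorphic_3_iff:
  "order_isomorphic [x, y, z] [a, b, c] \<longleftrightarrow>
     (x < y \<longleftrightarrow> a < b) \<and> (y < x \<longleftrightarrow> b < a) \<and> (x < z \<longleftrightarrow> a < c) \<and>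
     (z < x \<longleftrightarrow> c < a) \<and> (y < z \<longleftrightarrow> b < c) \<and> (z < y \<longleftrightarrow> c < b)"
  unfolding order_isomorphic_def by (simp add: All_less_Suc conj_ac)

lemma contains_pattern_3_iff:
  "contains_pattern p [a, b, c] \<longleftrightarrow>
     (\<exists>x y z. subseq [x, y, z] p \<and> order_isomorphic [x, y, z] [a, b, c])"
proof
  assume "contains_pattern p [a, b, c]"
  then obtain xs where xs: "subseq xs p" "order_isomorphic xs [a, b, c]"
    unfolding contains_pattern_def by blast
  then have "length xs = 3" by (simp add: order_isomorphic_def)
  then obtain x y z where "xs = [x, y, z]"
    by (auto simp: numeral_3_eq_3 length_Suc_conv)
  with xs show "\<exists>x y z. subseq [x, y, z] p \<and> order_isomorphic [x, y, z] [a, b, c]" by blast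
qed (auto simp: contains_pattern_def)

lemma avoids_iff_not_occurs3:
  "avoids p (if s then [3, 1, 2] else [2, 1, 3]) \<longleftrightarrow> \<not> occurs3 s p"
proof -
  have "order_isomorphic [x, y, z] [3, 1, 2] \<longleftrightarrow> y < z \<and> z < x"
    "order_isomorphic [x, y, z] [2, 1, 3] \<longleftrightarrow> y < x \<and> x < z" for x y z
    unfolding order_isomorphic_3_iff by auto
  then show ?thesis
    by (cases s) (simp_all add: avoids_def contains_pattern_3_iff occurs3_def)
qed

lemma occurs3_subseq: "occurs3 s p \<Longrightarrow> subseq p q \<Longrightarrow> occurs3 s q"
  unfolding occurs3_def by (meson subseq_order.order_trans)

text \<open>In both patterns the smallest letter is the middle one, so a pair \<open>a\<close>,
  \<open>b\<close> in the wrong order would form the pattern as \<open>[a, m, b]\<close>.\<close>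

lemma not_occurs3_append_ConsD:
  assumes "\<not> occurs3 s (A @ m # B)" "distinct (A @ m # B)"
    and "\<forall>a\<in>set A. m < a" "\<forall>b\<in>set B. m < b"
  shows "\<not> occurs3 s A" "\<not> occurs3 s B"
    "\<forall>a\<in>set A. \<forall>b\<in>set B. if s then a < b else b < a"
proof -
  have "subseq A (A @ m # B)" "subseq B (A @ m # B)"
    by (auto intro: prefix_imp_subseq suffix_imp_subseq simp: suffix_def)
  then show "\<not> occurs3 s A" "\<not> occurs3 s B" using assms(1) occurs3_subseq by blast+
  show "\<forall>a\<in>set A. \<forall>b\<in>set B. if s then a < b else b < a"
  proof (intro ballI)
    fix a b assume ab: "a \<in> set A" "b \<in> set B"
    have "subseq ([a] @ m # [b]) (A @ m # B)"
      using ab by (intro list_emb_append_mono) (auto simp: subseq_singleton_left)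
    then have "\<not> (if s then m < b \<and> b < a else m < a \<and> a < b)"
      using assms(1) unfolding occurs3_def by auto
    moreover have "a \<noteq> b" "m < a" "m < b" using ab assms by auto
    ultimately show "if s then a < b else b < a" by (auto split: if_splits)
  qed
qed

text \<open>An occurrence that starts in \<open>A\<close> and ends in \<open>B\<close> contradicts
  \<open>AB\<close>, and none can end at \<open>m\<close>, since \<open>z\<close> is never the
  smallest letter. Any other occurrence lies within \<open>A\<close> or within \<open>m # B\<close>;
  it cannot start at \<open>m\<close>, since \<open>x\<close> is not the smallest letter
  either.\<close>

lemma not_occurs3_append_ConsI:
  assumes A: "\<not> occurs3 s A" and B: "\<not> occurs3 s B"
    and m: "\<forall>a\<in>set A. m < a" "\<forall>b\<in>set B. m < b"
    and AB: "\<forall>a\<in>set A. \<forall>b\<in>set B. if s then a < b else b < a"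
  shows "\<not> occurs3 s (A @ m # B)"
proof
  assume "occurs3 s (A @ m # B)"
  then obtain x y z where xyz: "subseq [x, y, z] (A @ m # B)"
    and ord: "if s then y < z \<and> z < x else y < x \<and> x < z"
    unfolding occurs3_def by metis
  from xyz obtain us vs where uv: "[x, y, z] = us @ vs" "subseq us A" "subseq vs (m # B)"
    by (rule subseq_appendE)
  have sets: "set us \<subseteq> set A" "set vs \<subseteq> insert m (set B)"
    using uv(2,3) by (auto elim: list_emb_set)
  show False
  proof (cases "x \<in> set A \<and> z \<in> insert m (set B)")
    case True
    have "y \<in> set us \<union> set vs" using arg_cong[OF uv(1), of set] by auto
    then have "m \<le> y" using sets m by (auto dest: less_imp_le)
    \<comment> \<open>Both patterns require \<open>y < z\<close>, so \<open>z = m\<close> would put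
      \<open>y\<close> below the minimum.\<close>
    then have "z \<noteq> m" using True ord m by (auto split: if_splits)
    then have "if s then x < z else z < x" using True AB by (auto split: if_splits)
    then show False using ord by (auto split: if_splits)
  next
    case False
    \<comment> \<open>If both parts were nonempty, \<open>x\<close> would be in \<open>us\<close>
      and \<open>z\<close> in \<open>vs\<close>, which is the case already treated.\<close>
    then consider "vs = []" | "us = []"
      using uv(1) sets by (cases us; cases vs rule: rev_cases) auto
    then show False
    proof cases
      case 1
      then show False using uv ord A unfolding occurs3_def by auto
    next
      case 2
      then have *: "subseq [x, y, z] (m # B)" using uv by simp
      show False
      proof (cases "x = m")
        case True
        have "y \<in> insert m (set B)" using 2 uv sets by auto
        then show False using ord m True by (auto split: if_splits)
      next
        case False
        then have "subseq [x, y, z] B" using * by simp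
        then show False using ord B unfolding occurs3_def by blast
      qed
    qed
  qed
qed

section \<open>The bijection between trees and avoiding words\<close>

lemma length_tree_word [simp]: "length (tree_word s k t) = size t"
  by (induction t arbitrary: k) auto

lemma set_tree_word [simp]: "set (tree_word s k t) = {k..<k + size t}"
  by (induction t arbitrary: k) auto

lemma distinct_tree_word: "distinct (tree_word s k t)"
  by (induction t arbitrary: k) auto

lemma not_occurs3_tree_word: "\<not> occurs3 s (tree_word s k t)"
proof (induction t arbitrary: k)
  case Leaf
  then show ?case by (simp add: occurs3_def)
next
  case (Node l r)
  then show ?case
    unfolding tree_word.simps by (intro not_occurs3_append_ConsI) auto
qed

text \<open>The root label \<open>k\<close> occurs only once, so it splits the word uniquely. The
  lengths of the two sides give the subtree sizes, hence equal label offsets, and only then does the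
  induction hypothesis apply.\<close>

lemma tree_word_inject: "tree_word s k t = tree_word s k u \<Longrightarrow> t = u"
proof (induction t arbitrary: k u)
  case Leaf
  then show ?case by (cases u) auto
next
  case (Node l r)
  then obtain l' r' where u: "u = Node l' r'" by (cases u) auto
  let ?L = "\<lambda>l r. tree_word s (if s then k + 1 else k + 1 + size r) l"
  let ?R = "\<lambda>l r. tree_word s (if s then k + 1 + size l else k + 1) r"
  have "?L l r @ k # ?R l r = ?L l' r' @ k # ?R l' r'" using Node.prems u by simp
  moreover have "k \<notin> set (?L l r)" "k \<notin> set (?R l r)" by auto
  ultimately have eq: "?L l r = ?L l' r'" "?R l r = ?R l' r'"
    using append_Cons_eq_iff[of k "?L l r" "?R l r"] by blast+
  then have "size l = size l'" "size r = size r'" by (metis length_tree_word)+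
  then have "l = l'" "r = r'" using eq Node.IH by metis+
  then show ?case using u by simp
qed

text \<open>Turns the order relation between the two sides of a minimum into the label ranges that
  \<open>tree_word\<close> prescribes. Every element of the interval up to \<open>Max X\<close>
  belongs to \<open>X\<close>, because all of \<open>Y\<close> exceeds \<open>Max X\<close>.\<close>

lemma interval_split:
  fixes X Y :: "nat set"
  assumes un: "X \<union> Y = {a..<a + card X + card Y}" and less: "\<forall>x\<in>X. \<forall>y\<in>Y. x < y"
  shows "X = {a..<a + card X}" "Y = {a + card X..<a + card X + card Y}"
proof -
  have fin: "finite X" using un by (metis finite_Un finite_atLeastLessThan)
  show X: "X = {a..<a + card X}"
  proof (cases "X = {}")
    case False
    have "X = {a..Max X}"
    proof
      show "X \<subseteq> {a..Max X}" using un fin by auto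
      have "v \<in> X" if "v \<in> {a..Max X}" for v
      proof -
        have M: "Max X \<in> X" using fin False by simp
        then have "Max X \<in> {a..<a + card X + card Y}" using un by blast
        then have "v \<in> X \<union> Y" unfolding un using that by auto
        then show ?thesis using less M that by fastforce
      qed
      then show "{a..Max X} \<subseteq> X" by blast
    qed
    moreover have "{a..Max X} = {a..<a + card {a..Max X}}"
      by auto
    ultimately show ?thesis by metis
  qed simp
  have "X \<inter> Y = {}" using less by blast
  then have "Y = {a..<a + card X + card Y} - {a..<a + card X}" using un X by blast
  then show "Y = {a + card X..<a + card X + card Y}" by auto
qed

text \<open>Avoidance forces the two sides of the minimum \<open>k\<close> to consist of consecutive
  values, so by induction on the length each side is the word of a subtree.\<close>

lemma tree_word_surj:
  assumes "distinct p" "set p = {k..<k + length p}" "\<not> occurs3 s p"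
  shows "\<exists>t. tree_word s k t = p"
  using assms
proof (induction "length p" arbitrary: p k rule: less_induct)
  case less
  show ?case
  proof (cases "p = []")
    case True
    then show ?thesis by (metis tree_word.simps(1))
  next
    case False
    then have "k \<in> set p" using less.prems(2) by simp
    then obtain A B where p: "p = A @ k # B" by (meson split_list)
    have card: "card (set A) = length A" "card (set B) = length B"
      using less.prems(1) p by (auto simp: distinct_card)
    have un: "set A \<union> set B = {k + 1..<k + 1 + length A + length B}"
    proof -
      have "set A \<union> set B = set p - {k}" using p less.prems(1) by auto
      also have "\<dots> = {k + 1..<k + 1 + length A + length B}"
        unfolding less.prems(2) using p by auto
      finally show ?thesis .
    qed
    have "set A \<union> set B \<subseteq> {k<..}" unfolding un by auto
    then have gt: "\<forall>a\<in>set A. k < a" "\<forall>b\<in>set B. k < b" by auto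
    note avoid = not_occurs3_append_ConsD[OF less.prems(3,1)[unfolded p] gt]
    \<comment> \<open>The label offsets of \<open>tree_word\<close>, with lengths in place of the
      sizes of the subtrees still to be found.\<close>
    let ?kA = "if s then k + 1 else k + 1 + length B"
    let ?kB = "if s then k + 1 + length A else k + 1"
    \<comment> \<open>The lower side is \<open>A\<close> for 312 and \<open>B\<close> for 213, hence
      two instances with the roles exchanged.\<close>
    have sets: "set A = {?kA..<?kA + length A}" "set B = {?kB..<?kB + length B}"
      using interval_split[of "set A" "set B" "k + 1"] interval_split[of "set B" "set A" "k + 1"]
        un avoid(3) card
      by (cases s; simp add: Un_commute ac_simps)+
    obtain l where l: "tree_word s ?kA l = A"
      using less.hyps[of A ?kA] p less.prems(1) sets(1) avoid(1) by auto
    obtain r where r: "tree_word s ?kB r = B"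
      using less.hyps[of B ?kB] p less.prems(1) sets(2) avoid(2) by auto
    have "size l = length A" "size r = length B" using l r length_tree_word by metis+
    then have "tree_word s k (Node l r) = p" using l r p by (cases s) simp_all
    then show ?thesis by blast
  qed
qed

section \<open>Minima of intervals of positions\<close>

definition first_is_min :: "nat list \<Rightarrow> nat \<Rightarrow> nat \<Rightarrow> bool" where
  "first_is_min xs i j \<longleftrightarrow> (\<forall>h. i < h \<and> h \<le> j \<longrightarrow> xs ! i < xs ! h)"

text \<open>An interval containing position \<open>length A\<close> has its minimum there, so it
  must start there. Any other interval lies inside \<open>A\<close> or inside \<open>B\<close>.
  General intervals are considered because passing to a side loses the alignment of blocks with
  multiples of 3.\<close>

lemma first_is_min_append_Cons:
  assumes "\<forall>a\<in>set A. m < a" "\<forall>b\<in>set B. m < b" "i < j" "j \<le> length A + length B"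
  shows "first_is_min (A @ m # B) i j \<longleftrightarrow>
    (if j < length A then first_is_min A i j
     else length A = i \<or> length A < i \<and> first_is_min B (i - length A - 1) (j - length A - 1))"
proof -
  have left: "(A @ m # B) ! h = A ! h" if "h < length A" for h
    using that by (simp add: nth_append)
  have mid: "(A @ m # B) ! length A = m" by simp
  have right: "(A @ m # B) ! h = B ! (h - length A - 1)" if "length A < h" for h
    using that by (simp add: nth_append nth_Cons')
  consider "j < length A" | "i < length A" "length A \<le> j" | "i = length A" | "length A < i"
    by linarith
  then show ?thesis
  proof cases
    case 1
    then show ?thesis using \<open>i < j\<close> left by (simp add: first_is_min_def)
  next
    case 2
    then have "m < A ! i" using assms(1) by simp
    then have "\<not> (A @ m # B) ! i < (A @ m # B) ! length A" using left[of i] mid 2 by simp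
    then show ?thesis using 2 by (auto simp only: first_is_min_def split: if_splits)
  next
    case 3
    have "m < (A @ m # B) ! h" if "length A < h" "h \<le> j" for h
      using that right[of h] assms(2,4) by simp
    then show ?thesis using 3 mid \<open>i < j\<close> by (simp add: first_is_min_def)
  next
    case 4
    let ?i = "i - length A - 1" and ?j = "j - length A - 1"
    have "first_is_min (A @ m # B) i j \<longleftrightarrow> first_is_min B ?i ?j"
    proof
      assume *: "first_is_min (A @ m # B) i j"
      show "first_is_min B ?i ?j"
        unfolding first_is_min_def
      proof (intro allI impI)
        fix h assume "?i < h \<and> h \<le> ?j"
        then have "i < h + length A + 1 \<and> h + length A + 1 \<le> j" using 4 by linarith
        then have "(A @ m # B) ! i < (A @ m # B) ! (h + length A + 1)"
          using * unfolding first_is_min_def by blast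
        then show "B ! ?i < B ! h" using right[of i] right[of "h + length A + 1"] 4 by simp
      qed
    next
      assume *: "first_is_min B ?i ?j"
      show "first_is_min (A @ m # B) i j"
        unfolding first_is_min_def
      proof (intro allI impI)
        fix h assume h: "i < h \<and> h \<le> j"
        then have "?i < h - length A - 1 \<and> h - length A - 1 \<le> ?j" using 4 by linarith
        then have "B ! ?i < B ! (h - length A - 1)"
          using * unfolding first_is_min_def by blast
        then show "(A @ m # B) ! i < (A @ m # B) ! h" using right[of i] right[of h] 4 h by simp
      qed
    qed
    then show ?thesis using 4 \<open>i < j\<close> by simp
  qed
qed

text \<open>At the root, the criterion of \<open>first_is_min_append_Cons\<close> involves only
  positions and \<open>size l\<close>, neither labels nor the flag; what remains is recursion into a
  subtree. The start labels vary independently because the two flags shift subtree labels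
  differently.\<close>

lemma first_is_min_tree_word_iff:
  assumes "j < size t"
  shows "first_is_min (tree_word s k t) i j \<longleftrightarrow> first_is_min (tree_word s' k' t) i j"
  using assms
proof (induction t arbitrary: i j k k')
  case Leaf
  then show ?case by simp
next
  case (Node l r)
  show ?case
  proof (cases "i < j")
    case False
    then show ?thesis by (auto simp: first_is_min_def)
  next
    case True
    let ?L = "\<lambda>s k. tree_word s (if s then k + 1 else k + 1 + size r) l"
    let ?R = "\<lambda>s k. tree_word s (if s then k + 1 + size l else k + 1) r"
    have split: "first_is_min (tree_word s k (Node l r)) i j \<longleftrightarrow>
      (if j < size l then first_is_min (?L s k) i j
       else size l = i \<or>
         size l < i \<and> first_is_min (?R s k) (i - size l - 1) (j - size l - 1))" for s k
    proof -
      have gt: "\<forall>a\<in>set (?L s k). k < a" "\<forall>b\<in>set (?R s k). k < b" by auto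
      show ?thesis
        using first_is_min_append_Cons[OF gt True] Node.prems
        unfolding tree_word.simps length_tree_word by simp
    qed
    show ?thesis
    proof (cases "j < size l")
      case True
      then have "first_is_min (?L s k) i j \<longleftrightarrow> first_is_min (?L s' k') i j"
        by (rule Node.IH(1))
      then show ?thesis using True by (simp only: split if_True)
    next
      case False
      \<comment> \<open>With \<open>j = size l\<close> and an empty right subtree the truncated
        difference 0 is not below \<open>size r\<close>; \<open>size l < i\<close> and
        \<open>i < j\<close> exclude this.\<close>
      then have "j - size l - 1 < size r" if "size l < i" using Node.prems True that by simp
      then have "first_is_min (?R s k) (i - size l - 1) (j - size l - 1) \<longleftrightarrow>
          first_is_min (?R s' k') (i - size l - 1) (j - size l - 1)" if "size l < i"
        using that by (intro Node.IH(2)) blast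
      then show ?thesis using False by (auto simp only: split if_False)
    qed
  qed
qed

lemma tree_word_block_iff:
  assumes "i + 2 < size t"
  shows "tree_word s k t ! i < tree_word s k t ! (i + 1) \<and>
         tree_word s k t ! i < tree_word s k t ! (i + 2) \<longleftrightarrow>
         tree_word s' k t ! i < tree_word s' k t ! (i + 1) \<and>
         tree_word s' k t ! i < tree_word s' k t ! (i + 2)"
proof -
  have h: "i < h \<and> h \<le> i + 2 \<longleftrightarrow> h = i + 1 \<or> h = i + 2" for h by auto
  show ?thesis
    using first_is_min_tree_word_iff[OF assms, of s k i s' k]
    unfolding first_is_min_def h by blast
qed

section \<open>Transfer of the block condition to trees, and counting\<close>

definition block_trees :: "nat \<Rightarrow> bool \<Rightarrow> bin_tree set" where
  "block_trees n s = {t. size t = 3 * n \<and>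
     (\<forall>i < n. tree_word s 1 t ! (3 * i) < tree_word s 1 t ! (3 * i + 1) \<and>
              tree_word s 1 t ! (3 * i) < tree_word s 1 t ! (3 * i + 2))}"

lemma block_trees_eq: "block_trees n s = block_trees n s'"
proof -
  have "tree_word s 1 t ! (3 * i) < tree_word s 1 t ! (3 * i + 1) \<and>
        tree_word s 1 t ! (3 * i) < tree_word s 1 t ! (3 * i + 2) \<longleftrightarrow>
        tree_word s' 1 t ! (3 * i) < tree_word s' 1 t ! (3 * i + 1) \<and>
        tree_word s' 1 t ! (3 * i) < tree_word s' 1 t ! (3 * i + 2)"
    if "size t = 3 * n" "i < n" for t i
    using that by (intro tree_word_block_iff) simp
  then show ?thesis unfolding block_trees_def by blast
qed

text \<open>One flagged statement covers both classes; as \<open>tree_word\<close> is injective, it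
  reduces their sizes to counting trees.\<close>

lemma S2_eq_image_tree_word:
  "S2 n {if s then [3, 1, 2] else [2, 1, 3]} = tree_word s 1 ` block_trees n s"
proof (intro set_eqI iffI)
  fix p assume p: "p \<in> S2 n {if s then [3, 1, 2] else [2, 1, 3]}"
  then have perm: "p \<in> permutations_of_set {1..3 * n}" and "\<not> occurs3 s p"
    by (simp_all only: S2_def avoids_iff_not_occurs3 mem_Collect_eq ball_simps simp_thms)
  moreover have len: "length p = 3 * n" using perm by (auto dest: length_finite_permutations_of_set)
  \<comment> \<open>The half-open form that \<open>tree_word_surj\<close> expects for least label
    1.\<close>
  moreover have "{1..3 * n} = {1..<1 + 3 * n}" by auto
  ultimately obtain t where t: "tree_word s 1 t = p"
    using tree_word_surj[of p 1 s] by (auto simp: permutations_of_set_def)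
  then have "size t = 3 * n" using len length_tree_word by metis
  then show "p \<in> tree_word s 1 ` block_trees n s"
    using p t by (auto simp: S2_def block_trees_def)
next
  fix p assume "p \<in> tree_word s 1 ` block_trees n s"
  then obtain t where t: "t \<in> block_trees n s" "p = tree_word s 1 t" by blast
  then have "set p = {1..3 * n}" "distinct p" "\<not> occurs3 s p"
    using distinct_tree_word not_occurs3_tree_word by (auto simp: block_trees_def)
  then show "p \<in> S2 n {if s then [3, 1, 2] else [2, 1, 3]}"
    using t unfolding S2_def
    by (simp only: mem_Collect_eq ball_simps simp_thms avoids_iff_not_occurs3)
       (simp add: block_trees_def permutations_of_set_def)
qed

theorem theorem12:
  fixes n :: nat
  shows "card (S2 n {[2, 1, 3]}) = card (S2 n {[3, 1, 2]})"
proof -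
  have "card (S2 n {if s then [3, 1, 2] else [2, 1, 3]}) = card (block_trees n s)" for s
    unfolding S2_eq_image_tree_word by (auto intro: card_image inj_onI tree_word_inject)
  from this[of True] this[of False] show ?thesis
    using block_trees_eq[of n True False] by simp
qed

end
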